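(* For any real $p\ge4$, $$\tfrac12\,d_{\mathrm{TV}}(p)=d_{\mathrm{Ko}}(p)<\frac Cp,$$ where $$C:=\frac14\sqrt{\frac{7+5\sqrt2}{\pi e^{1+\sqrt2}}}=0.158\dots.$$ Moreover, $$\lim_{p\to\infty}p\,d_{\mathrm{Ko}}(p)=C,$$ so that the constant $C$ is the best possible one in the inequality $d_{\mathrm{Ko}}(p)<C/p$.
   Context: For real $p>0$ (not necessarily an integer), the density and distribution functions of Student's distribution with $p$ degrees of freedom are $$f_p(x)=\frac{\Gamma\left(\frac{p+1}{2}\right)}{\sqrt{\pi p}\,\Gamma\left(\frac p2\right)}\left(1+\frac{x^2}{p}\right)^{-(p+1)/2},\qquad F_p(x)=\int_{-\infty}^x f_p(u)\,du,\qquad x\in\mathbb{R}.$$ $\varphi$ and $\Phi$ are the density and distribution functions of the standard normal distribution. For real $p>0$, $$d_{\mathrm{Ko}}(p)=\sup_{x\in\mathbb{R}}|F_p(x)-\Phi(x)|,\qquad d_{\mathrm{TV}}(p)=\frac12\int_{-\infty}^\infty|f_p(x)-\varphi(x)|\,dx.$$ *)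

theory Defs
  imports "HOL-Probability.Probability"
begin

definition student_density :: "real \<Rightarrow> real \<Rightarrow> real" where
  "student_density p x =
     Gamma ((p + 1) / 2) / (sqrt (pi * p) * Gamma (p / 2)) * (1 + x\<^sup>2 / p) powr (- (p + 1) / 2)"

definition student_cdf :: "real \<Rightarrow> real \<Rightarrow> real" where
  "student_cdf p x = (LBINT u:{..x}. student_density p u)"

text \<open>
  Both quantities below are meant for \<open>p > 0\<close>. There the real-valued supremum ranges over a set
  bounded above, and the integrand of the total variation distance is integrable, so neither
  definition falls back on a junk value.
\<close>

definition d_Ko :: "real \<Rightarrow> real" where
  "d_Ko p = (SUP x. \<bar>student_cdf p x - cdf std_normal_distribution x\<bar>)"

definition d_TV :: "real \<Rightarrow> real" where
  "d_TV p = 1 / 2 * (LBINT x. \<bar>student_density p x - std_normal_density x\<bar>)"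

definition const_C :: real where
  "const_C = 1 / 4 * sqrt ((7 + 5 * sqrt 2) / (pi * exp (1 + sqrt 2)))"

end

theory Submission
  imports Defs "HOL-Real_Asymp.Real_Asymp"
begin

text \<open>
  Write \<open>t = 1 / p\<close>, \<open>u = x\<^sup>2\<close>, let \<open>f\<close> be the Student density and \<open>\<phi>\<close> the normal density. Then
  \<open>f x = \<phi> x * r u\<close>, where \<open>r u = c * exp (u / 2) * (1 + u / p) powr (- (p + 1) / 2)\<close> and \<open>c\<close> is a
  quotient of Gamma values.

  \<^bold>\<open>Equality of the distances.\<close> The logarithmic derivative of \<open>r\<close> is \<open>(u - 1) / (2 * (p + u))\<close>, so
  \<open>r\<close> decreases on \<open>[0, 1]\<close> and increases afterwards; moreover \<open>r 0 = c < 1 < r 3\<close>. Hence there is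
  an \<open>a\<close> with \<open>a\<^sup>2 \<le> 3\<close> such that \<open>f \<le> \<phi>\<close> on \<open>[-a, a]\<close> and \<open>f \<ge> \<phi>\<close> outside. As \<open>f - \<phi>\<close> is even and
  has integral 0, its primitive is extremal at \<open>\<plusminus>a\<close>, and both the Kolmogorov distance and half the
  total variation distance equal half the integral of \<open>\<phi> - f\<close> over \<open>[-a, a]\<close>.

  \<^bold>\<open>The constant.\<close> To first order, \<open>r u = 1 + t * (u\<^sup>2 - 2 * u - 1) / 4\<close>. The function
  \<open>- \<phi> x * (x\<^sup>4 - 2 * x\<^sup>2 - 1) / 4\<close> is the derivative of the odd function \<open>edgeworth\<close>, whose maximum is
  attained at \<open>x\<^sup>2 = 1 + sqrt 2\<close> and equals \<open>const_C\<close>. This gives the limit: integrating over \<open>[-b, b]\<close>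
  with \<open>b\<^sup>2 = 1 + sqrt 2\<close> bounds the Kolmogorov distance from below by \<open>const_C / p - O(1 / p\<^sup>2)\<close>.

  \<^bold>\<open>The strict inequality.\<close> The next term of the expansion has the favourable sign. To exploit it
  without error estimates, \<open>r\<close> is bounded from below, for \<open>u \<le> 3\<close> and \<open>p \<ge> 4\<close>, by an explicit polynomial
  \<open>minorant\<close> in \<open>u\<close> and \<open>t\<close>. The polynomial is built so that \<open>\<phi> x * (1 - minorant t (x\<^sup>2))\<close> has the
  elementary primitive \<open>t * edgeworth x - t\<^sup>2 * \<phi> x * x * correction t (x\<^sup>2)\<close>, where the correction is
  positive on the relevant range. Consequently the Kolmogorov distance is less than
  \<open>t * edgeworth a\<close>, hence less than \<open>t * const_C\<close>. That \<open>minorant\<close> lies below \<open>r\<close> is verified at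
  \<open>u = 0\<close>, where it follows from \<open>c \<ge> exp (- t / 4)\<close>, and then propagated by comparing logarithmic
  derivatives; up to a factor \<open>t\<^sup>3\<close>, that comparison is a polynomial inequality affine in \<open>t\<close>.
\<close>

section \<open>Elementary inequalities\<close>

lemma exp_ge_cubic: "1 + x + x\<^sup>2 / 2 + x ^ 3 / 6 \<le> exp (x :: real)"
proof -
  obtain s where "exp x = (\<Sum>m<4. x ^ m / fact m) + exp s / fact 4 * x ^ 4"
    using Maclaurin_exp_le[of x 4] by blast
  moreover have "exp s / fact 4 * x ^ 4 \<ge> 0" by simp
  moreover have "(\<Sum>m<4. x ^ m / fact m) = 1 + x + x\<^sup>2 / 2 + x ^ 3 / 6"
    by (simp add: eval_nat_numeral)
  ultimately show ?thesis by linarith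
qed

text \<open>
  For negative \<open>y\<close> this rests on \<open>exp y \<le> 1 / (1 - y)\<close> and \<open>(1 - y) * (1 + y + y\<^sup>2) = 1 - y\<^sup>3 \<ge> 1\<close>.
\<close>
lemma exp_le_quadratic:
  fixes y :: real
  assumes "y \<le> 1"
  shows "exp y \<le> 1 + y + y\<^sup>2"
proof (cases "y \<ge> 0")
  case True
  thus ?thesis using exp_bound[of y] assms by simp
next
  case False
  have "(1 - y) * exp y \<le> exp (- y) * exp y"
    using exp_ge_add_one_self[of "- y"] by (intro mult_right_mono) auto
  also have "\<dots> = 1" by (simp flip: exp_add)
  also have "1 \<le> (1 - y) * (1 + y + y\<^sup>2)"
  proof -
    have "(- y) ^ 3 \<ge> 0" using False by (intro zero_le_power) auto
    thus ?thesis by (simp add: algebra_simps power2_eq_square power3_eq_cube)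
  qed
  finally show ?thesis using False by simp
qed

lemma ln_one_plus_ge:
  fixes y :: real
  assumes "y \<ge> 0"
  shows "y - y\<^sup>2 / 2 \<le> ln (1 + y)"
proof -
  have "ln (1 + 0) - (0 - 0\<^sup>2 / 2) \<le> ln (1 + y) - (y - y\<^sup>2 / 2)"
  proof (rule DERIV_nonneg_imp_nondecreasing[OF assms])
    fix x :: real assume x: "0 \<le> x"
    have "((\<lambda>y. ln (1 + y) - (y - y\<^sup>2 / 2)) has_real_derivative (1 / (1 + x) - (1 - x))) (at x)"
      using x by (auto intro!: derivative_eq_intros)
    moreover have "1 / (1 + x) - (1 - x) = x\<^sup>2 / (1 + x)"
      using x by (simp add: field_simps power2_eq_square)
    ultimately show "\<exists>d. ((\<lambda>y. ln (1 + y) - (y - y\<^sup>2 / 2)) has_real_derivative d) (at x) \<and> d \<ge> 0"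
      using x by auto
  qed
  thus ?thesis by simp
qed

section \<open>The quotient of Gamma values in the normalising constant\<close>

text \<open>
  With this scaling, which is the value at 0 of the quotient of the Student and the normal density,
  \<open>gamma_ratio p\<close> tends to 1.
\<close>
definition gamma_ratio :: "real \<Rightarrow> real" where
  "gamma_ratio p = Gamma ((p + 1) / 2) / (Gamma (p / 2) * sqrt (p / 2))"

lemma gamma_ratio_pos: "p > 0 \<Longrightarrow> gamma_ratio p > 0"
  unfolding gamma_ratio_def by (intro divide_pos_pos mult_pos_pos Gamma_real_pos) auto

lemma gamma_ratio_mult_shift:
  assumes "p > 0"
  shows "gamma_ratio p * gamma_ratio (p + 1) = sqrt (p / (p + 1))"
proof -
  have "Gamma ((p + 1 + 1) / 2) = Gamma (p / 2 + 1)" by (simp add: field_simps)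
  also have "\<dots> = p / 2 * Gamma (p / 2)"
    by (rule Gamma_plus1) (use assms in \<open>auto elim!: nonpos_Ints_cases'\<close>)
  finally have shift: "Gamma ((p + 1 + 1) / 2) = p / 2 * Gamma (p / 2)" .
  have "Gamma (p / 2) > 0" "Gamma ((p + 1) / 2) > 0"
    using assms by (auto intro!: Gamma_real_pos)
  hence "gamma_ratio p * gamma_ratio (p + 1) = (p / 2) / (sqrt (p / 2) * sqrt ((p + 1) / 2))"
    unfolding gamma_ratio_def shift by (simp add: field_simps)
  also have "\<dots> = sqrt (p / 2) / sqrt ((p + 1) / 2)"
    using assms by (simp add: real_div_sqrt flip: divide_divide_eq_left)
  also have "\<dots> = sqrt ((p / 2) / ((p + 1) / 2))"
    by (simp only: real_sqrt_divide)
  also have "(p / 2) / ((p + 1) / 2) = p / (p + 1)" by simp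
  finally show ?thesis .
qed

text \<open>
  The midpoint of \<open>p / 2\<close> and \<open>p / 2 + 1\<close> is \<open>(p + 1) / 2\<close>, so this is log-convexity of the Gamma
  function. Together with the product formula it forces the limit 1.
\<close>
lemma gamma_ratio_le_1:
  assumes "p > 0"
  shows "gamma_ratio p \<le> 1"
proof -
  have pos: "Gamma (p / 2) > 0" "Gamma ((p + 1) / 2) > 0"
    using assms by (auto intro!: Gamma_real_pos)
  have Suc: "Gamma (p / 2 + 1) = p / 2 * Gamma (p / 2)"
    by (rule Gamma_plus1) (use assms in \<open>auto elim!: nonpos_Ints_cases'\<close>)
  have half: "1/2 * a + 1/2 * (b + a) = a + b / 2" for a b :: real
    by (simp add: field_simps)
  have mid: "(1 - 1/2) *\<^sub>R (p/2) + (1/2) *\<^sub>R (p/2 + 1 :: real) = (p + 1) / 2"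
    by (simp add: field_simps)
  have "(ln \<circ> Gamma) ((1 - 1/2) *\<^sub>R (p/2) + (1/2) *\<^sub>R (p/2 + 1 :: real))
      \<le> (1 - 1/2) * (ln \<circ> Gamma) (p/2) + 1/2 * (ln \<circ> Gamma) (p/2 + 1 :: real)"
    by (rule convex_onD[OF log_convex_Gamma_real]) (use assms in auto)
  hence "ln (Gamma ((p + 1) / 2)) \<le> 1/2 * ln (Gamma (p / 2)) + 1/2 * ln (p / 2 * Gamma (p / 2))"
    unfolding mid by (simp add: Suc)
  also have "ln (p / 2 * Gamma (p / 2)) = ln (p / 2) + ln (Gamma (p / 2))"
    by (rule ln_mult_pos[OF _ pos(1)]) (use assms in simp)
  also have "1/2 * ln (Gamma (p / 2)) + 1/2 * (ln (p / 2) + ln (Gamma (p / 2))) = ln (Gamma (p / 2)) + ln (p / 2) / 2"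
    using half[of "ln (Gamma (p / 2))" "ln (p / 2)"] .
  also have "\<dots> = ln (Gamma (p / 2) * sqrt (p / 2))"
    using ln_mult_pos[OF pos(1), of "sqrt (p / 2)"] assms by (simp add: ln_sqrt)
  finally have "Gamma ((p + 1) / 2) \<le> Gamma (p / 2) * sqrt (p / 2)"
    using pos assms by (subst (asm) ln_le_cancel_iff) auto
  thus ?thesis unfolding gamma_ratio_def using pos assms by (simp add: divide_le_eq_1)
qed

lemma gamma_ratio_tendsto_1: "(gamma_ratio \<longlongrightarrow> 1) at_top"
proof (rule tendsto_sandwich)
  show "\<forall>\<^sub>F p in at_top. gamma_ratio p \<le> 1"
    using eventually_gt_at_top[of 0] by eventually_elim (rule gamma_ratio_le_1)
  show "\<forall>\<^sub>F p in at_top. sqrt (p / (p + 1)) \<le> gamma_ratio p"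
    using eventually_gt_at_top[of 0]
  proof eventually_elim
    case (elim p)
    have "gamma_ratio p * gamma_ratio (p + 1) \<le> gamma_ratio p * 1"
      using elim gamma_ratio_le_1[of "p + 1"] gamma_ratio_pos[of p]
      by (intro mult_left_mono) auto
    thus ?case using gamma_ratio_mult_shift[OF elim] by simp
  qed
  show "((\<lambda>p::real. sqrt (p / (p + 1))) \<longlongrightarrow> 1) at_top" by real_asymp
qed auto

text \<open>
  The recursion of the Gamma function gives \<open>gamma_ratio (p + 2) / gamma_ratio p =
  sqrt (1 + 1 / (p * (p + 2)))\<close>, while \<open>1 / (4 * p) - 1 / (4 * (p + 2)) = 1 / (2 * p * (p + 2))\<close>; thus the
  claim is just \<open>1 + y \<le> exp y\<close>.
\<close>
lemma gamma_ratio_step2: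
  assumes "p > 0"
  shows "gamma_ratio (p + 2) * exp (1 / (4 * (p + 2))) \<le> gamma_ratio p * exp (1 / (4 * p))"
proof -
  have *: "gamma_ratio p * gamma_ratio (p + 1) = sqrt (p / (p + 1))"
    "gamma_ratio (p + 1) * gamma_ratio (p + 2) = sqrt ((p + 1) / (p + 2))"
    using gamma_ratio_mult_shift[of p] gamma_ratio_mult_shift[of "p + 1"] assms
    by (simp_all add: add.assoc)
  have "gamma_ratio (p + 2) * (gamma_ratio p * gamma_ratio (p + 1))
      = gamma_ratio p * (gamma_ratio (p + 1) * gamma_ratio (p + 2))" by (simp add: algebra_simps)
  hence "gamma_ratio (p + 2) * sqrt (p / (p + 1)) = gamma_ratio p * sqrt ((p + 1) / (p + 2))"
    unfolding * .
  hence "gamma_ratio (p + 2) = gamma_ratio p * (sqrt ((p + 1) / (p + 2)) / sqrt (p / (p + 1)))"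
    using assms by (simp add: field_simps)
  also have "sqrt ((p + 1) / (p + 2)) / sqrt (p / (p + 1)) = sqrt (1 + 1 / (p * (p + 2)))"
    unfolding real_sqrt_divide[symmetric] using assms
    by (intro arg_cong[where f = sqrt]) (simp add: divide_simps, simp add: algebra_simps)
  also have "\<dots> \<le> sqrt (exp (1 / (p * (p + 2))))"
    by simp
  also have "\<dots> = exp (1 / (2 * p * (p + 2)))"
    by (rule real_sqrt_unique) (auto simp: power2_eq_square simp flip: exp_add)
  finally have "gamma_ratio (p + 2) \<le> gamma_ratio p * exp (1 / (2 * p * (p + 2)))"
    using gamma_ratio_pos[OF assms] by simp
  hence "gamma_ratio (p + 2) * exp (1 / (4 * (p + 2)))
    \<le> gamma_ratio p * (exp (1 / (2 * p * (p + 2))) * exp (1 / (4 * (p + 2))))"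
    by simp
  also have "exp (1 / (2 * p * (p + 2))) * exp (1 / (4 * (p + 2))) = exp (1 / (4 * p))"
    unfolding exp_add[symmetric] using assms
    by (intro arg_cong[where f = exp]) (simp add: divide_simps, simp add: algebra_simps)
  finally show ?thesis .
qed

text \<open>
  \<open>gamma_ratio p * exp (1 / (4 * p))\<close> decreases to its limit 1 along \<open>p, p + 2, p + 4, \<dots>\<close>.
\<close>
lemma gamma_ratio_ge:
  assumes "p > 0"
  shows "gamma_ratio p \<ge> exp (- (1 / (4 * p)))"
proof -
  define a where "a n = gamma_ratio (p + 2 * real n) * exp (1 / (4 * (p + 2 * real n)))" for n
  have top: "filterlim (\<lambda>n. p + 2 * real n) at_top sequentially" by real_asymp
  have "a \<longlonglongrightarrow> 1 * 1" unfolding a_def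
  proof (rule tendsto_mult)
    show "(\<lambda>n. gamma_ratio (p + 2 * real n)) \<longlonglongrightarrow> 1"
      by (rule filterlim_compose[OF gamma_ratio_tendsto_1 top])
    show "(\<lambda>n. exp (1 / (4 * (p + 2 * real n)))) \<longlonglongrightarrow> 1" by real_asymp
  qed
  moreover have "decseq a"
  proof (rule decseq_SucI)
    fix n show "a (Suc n) \<le> a n"
      using gamma_ratio_step2[of "p + 2 * real n"] assms unfolding a_def by (simp add: algebra_simps)
  qed
  ultimately have "1 \<le> a 0" using decseq_ge[of a 1 0] by simp
  thus ?thesis unfolding a_def by (simp add: exp_minus field_simps)
qed

text \<open>
  The product formula turns the lower bound at \<open>p + 1\<close> into an upper bound at \<open>p\<close>.
\<close>
lemma gamma_ratio_le:
  assumes "p > 0"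
  shows "gamma_ratio p \<le> sqrt (p / (p + 1)) * exp (1 / (4 * (p + 1)))"
proof -
  have "gamma_ratio p * exp (- (1 / (4 * (p + 1)))) \<le> gamma_ratio p * gamma_ratio (p + 1)"
    using gamma_ratio_ge[of "p + 1"] gamma_ratio_pos[of p] assms by (intro mult_left_mono) auto
  thus ?thesis
    unfolding gamma_ratio_mult_shift[OF assms] by (simp add: exp_minus field_simps)
qed

lemma gamma_ratio_le_exp:
  assumes "p \<ge> 1"
  shows "gamma_ratio p \<le> exp (- (1 / (4 * p)) + 1 / (2 * p\<^sup>2))"
proof -
  have "sqrt (p / (p + 1)) = exp (- (ln (1 + 1 / p) / 2))"
  proof (rule real_sqrt_unique)
    have "exp (- (ln (1 + 1 / p) / 2)) ^ 2 = exp (- ln (1 + 1 / p))"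
      by (simp add: power2_eq_square flip: exp_add)
    also have "\<dots> = p / (p + 1)" using assms
      by (simp add: exp_minus add_pos_pos field_simps)
    finally show "exp (- (ln (1 + 1 / p) / 2)) ^ 2 = p / (p + 1)" .
  qed auto
  hence "gamma_ratio p \<le> exp (- (ln (1 + 1 / p) / 2) + 1 / (4 * (p + 1)))"
    using gamma_ratio_le[of p] assms by (simp only: exp_add)
  also have "\<dots> \<le> exp (- (1 / (4 * p)) + 1 / (2 * p\<^sup>2))"
  proof -
    have "ln (1 + 1 / p) \<ge> 1 / p - (1 / p)\<^sup>2"
      using assms by (intro ln_one_plus_pos_lower_bound) auto
    moreover have "1 / (4 * (p + 1)) \<le> 1 / (4 * p)" using assms by (simp add: field_simps)
    ultimately show ?thesis by (simp add: power_divide)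
  qed
  finally show ?thesis .
qed

lemma gamma_ratio_less_1:
  assumes "p > 0"
  shows "gamma_ratio p < 1"
proof -
  have "gamma_ratio p ^ 2 \<le> (sqrt (p / (p + 1)) * exp (1 / (4 * (p + 1)))) ^ 2"
    using gamma_ratio_le[OF assms] gamma_ratio_pos[OF assms] by (intro power_mono) auto
  also have "\<dots> = p / (p + 1) * exp (1 / (2 * (p + 1)))"
  proof -
    have "1 / (2 * (p + 1)) = 1 / (4 * (p + 1)) + 1 / (4 * (p + 1))"
      using assms by (simp add: divide_simps)
    hence "exp (1 / (2 * (p + 1))) = (exp (1 / (4 * (p + 1))))\<^sup>2"
      by (simp only: exp_add power2_eq_square)
    thus ?thesis using assms by (simp only: power_mult_distrib) simp
  qed
  also have "\<dots> < p / (p + 1) * exp (1 / (p + 1))"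
    using assms by (intro mult_strict_left_mono) (auto simp: divide_simps)
  also have "p / (p + 1) \<le> exp (- (1 / (p + 1)))"
    using exp_ge_add_one_self[of "- (1 / (p + 1))"] assms by (simp add: field_simps)
  finally show ?thesis
    using assms by (simp add: exp_minus power_less_one_iff abs_square_less_1)
qed

section \<open>The Student density has total mass one\<close>

text \<open>
  The substitution \<open>x = sqrt (p * s / (1 - s))\<close>, that is \<open>1 + x\<^sup>2 / p = 1 / (1 - s)\<close>, turns the half-line
  integral of the kernel into a Beta integral. It is applied in the direction from \<open>(0, 1)\<close> to the
  half-line because integrability of the Beta integrand is what is known beforehand.
\<close>
lemma student_kernel_substitution:
  assumes "p > 0"
  defines "k \<equiv> (\<lambda>x::real. (1 + x\<^sup>2 / p) powr (- (p + 1) / 2))"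
  shows "set_integrable lborel (einterval 0 \<infinity>) k"
    and "(LBINT x=0..\<infinity>. k x) = sqrt p / 2 * Beta (1 / 2) (p / 2)"
proof -
  define g where "g t = sqrt p * (t powr (1 / 2) * (1 - t) powr (- (1 / 2)))" for t :: real
  define g' where "g' t = sqrt p / 2 * (t powr (- (1 / 2)) * (1 - t) powr (- (3 / 2)))" for t :: real
  define w where "w t = t powr (1 / 2 - 1) * (1 - t) powr (p / 2 - 1)" for t :: real
  have kg: "k (g t) * g' t = sqrt p / 2 * w t" if "t > 0" "t < 1" for t
  proof -
    have "(g t)\<^sup>2 = p * (t * (1 - t) powr (-1))"
      using that assms unfolding g_def
      by (simp add: power_mult_distrib power2_eq_square[of "_ powr _"] flip: powr_add)
    hence "1 + (g t)\<^sup>2 / p = (1 - t) powr (-1)"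
      using that assms by (simp add: powr_minus field_simps)
    hence "k (g t) = (1 - t) powr ((p + 1) / 2)"
      unfolding k_def by (simp only: powr_powr) (simp add: add.commute)
    hence "k (g t) * g' t = sqrt p / 2 * (t powr (- (1 / 2)) * ((1 - t) powr ((p + 1) / 2) * (1 - t) powr (- (3 / 2))))"
      unfolding g'_def by simp
    also have "(1 - t) powr ((p + 1) / 2) * (1 - t) powr (- (3 / 2)) = (1 - t) powr (p / 2 - 1)"
      unfolding powr_add[symmetric] by (intro arg_cong[where f = "\<lambda>a. (1 - t) powr a"]) (simp add: field_simps)
    finally show ?thesis by (simp add: w_def)
  qed
  have beta: "(w has_integral Beta (1 / 2) (p / 2)) {0..1}"
    using has_integral_Beta_real[of "1 / 2" "p / 2"] assms unfolding w_def by simp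
  have w_abs: "w absolutely_integrable_on {0..1}"
    by (rule nonnegative_absolutely_integrable_1) (use beta in \<open>auto simp: w_def integrable_on_def\<close>)
  have w_meas: "w \<in> borel_measurable borel" unfolding w_def by measurable
  have w_Icc: "set_integrable lborel {0..1} w"
    using w_abs w_meas unfolding set_integrable_def by (subst (asm) integrable_completion) auto
  have w_int: "(LBINT t:{0..1}. w t) = Beta (1 / 2) (p / 2)"
    using set_borel_integral_eq_integral(2)[OF w_Icc] beta by (simp add: integral_unique)
  have e01: "einterval 0 1 = {0<..<1::real}" by (auto simp: einterval_def)
  have w_Ioo: "set_integrable lborel (einterval 0 1) w"
    unfolding e01 by (rule set_integrable_subset[OF w_Icc]) auto
  have kg_int: "set_integrable lborel (einterval 0 1) (\<lambda>t. k (g t) * g' t)"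
  proof (subst set_integrable_cong[OF refl refl])
    show "set_integrable lborel (einterval 0 1) (\<lambda>t. sqrt p / 2 * w t)"
      using w_Ioo by (rule set_integrable_mult_right)
  qed (auto simp: e01 kg)
  have lim0: "((ereal \<circ> g \<circ> real_of_ereal) \<longlongrightarrow> 0) (at_right 0)"
  proof -
    have "(g \<longlongrightarrow> 0) (at_right 0)" unfolding g_def by real_asymp
    thus ?thesis unfolding zero_ereal_def by (simp add: ereal_tendsto_simps)
  qed
  have lim1: "((ereal \<circ> g \<circ> real_of_ereal) \<longlongrightarrow> \<infinity>) (at_left 1)"
  proof -
    have "filterlim g at_top (at_left 1)" unfolding g_def using assms by real_asymp
    thus ?thesis unfolding one_ereal_def by (simp add: ereal_tendsto_simps)
  qed
  have deriv: "(g has_real_derivative g' t) (at t)" if "t > 0" "t < 1" for t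
  proof -
    have "(g has_real_derivative sqrt p * (t powr (1 / 2) * (1 / 2 * (1 - t) powr (- (1 / 2) - 1))
           + 1 / 2 * t powr (1 / 2 - 1) * (1 - t) powr (- (1 / 2)))) (at t)"
      unfolding g_def using that by (auto intro!: derivative_eq_intros)
    also have "t powr (1 / 2) = t * t powr (- (1 / 2))"
      using that powr_mult_base[of t "- (1 / 2)"] by simp
    also have "(1 - t) powr (- (1 / 2)) = (1 - t) * (1 - t) powr (- (3 / 2))"
      using that powr_mult_base[of "1 - t" "- (3 / 2)"] by simp
    finally show ?thesis by (simp add: g'_def algebra_simps)
  qed
  have cont_k: "isCont k x" for x
  proof -
    have "1 + x\<^sup>2 / p > 0" using assms by (intro add_pos_nonneg) auto
    thus ?thesis unfolding k_def using assms by (intro continuous_intros) auto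
  qed
  note subst = interval_integral_substitution_nonneg[of 0 1 g g' k 0 \<infinity>, OF _ _ _ _ _ _ lim0 lim1 kg_int]
  have cont_g': "isCont g' t" if "t > 0" "t < 1" for t
    unfolding g'_def using that by (intro continuous_intros) auto
  have *: "set_integrable lborel (einterval 0 \<infinity>) k"
       "(LBINT x=0..\<infinity>. k x) = (LBINT t=0..1. k (g t) * g' t)"
    by (rule subst; use deriv cont_k cont_g' assms in \<open>simp add: k_def g'_def\<close>)+
  show "set_integrable lborel (einterval 0 \<infinity>) k" by (rule *)
  have "(LBINT t=0..1. k (g t) * g' t) = (LBINT t:{0<..<1}. k (g t) * g' t)"
    by (simp add: interval_lebesgue_integral_def e01)
  also have "\<dots> = (LBINT t:{0<..<1}. sqrt p / 2 * w t)"
    by (rule set_lebesgue_integral_cong) (auto simp: kg)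
  also have "\<dots> = sqrt p / 2 * (LBINT t:{0<..<1}. w t)"
    by simp
  also have "(LBINT t:{0<..<1}. w t) = (LBINT t:{0..1}. w t)"
    using interval_integral_Icc[of 0 1 w] by (simp add: interval_lebesgue_integral_def e01 zero_ereal_def one_ereal_def)
  finally show "(LBINT x=0..\<infinity>. k x) = sqrt p / 2 * Beta (1 / 2) (p / 2)"
    using * w_int assms by simp
qed

lemma student_density_even: "student_density p (- x) = student_density p x"
  by (simp add: student_density_def)

lemma
  assumes "p > 0"
  shows integrable_student_density: "integrable lborel (student_density p)"
    and integral_student_density: "(LBINT x. student_density p x) = 1"
proof -
  define k where "k = (\<lambda>x::real. (1 + x\<^sup>2 / p) powr (- (p + 1) / 2))"
  define K where "K = Gamma ((p + 1) / 2) / (sqrt (pi * p) * Gamma (p / 2))"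
  have dens: "student_density p = (\<lambda>x. K * k x)"
    by (simp add: fun_eq_iff student_density_def K_def k_def)
  have e: "einterval 0 \<infinity> = {0::real<..}" by (auto simp: einterval_def)
  note k = student_kernel_substitution[OF assms, folded k_def]
  have pos: "has_bochner_integral lborel (\<lambda>x. indicator {0..} x *\<^sub>R k x) (sqrt p / 2 * Beta (1 / 2) (p / 2))"
  proof -
    have "has_bochner_integral lborel (\<lambda>x. indicator {0<..} x *\<^sub>R k x) (sqrt p / 2 * Beta (1 / 2) (p / 2))"
      using k by (auto simp: has_bochner_integral_iff set_integrable_def set_lebesgue_integral_def
          interval_lebesgue_integral_def e)
    moreover have "AE x in lborel. indicator {0<..} x *\<^sub>R k x = indicator {0..} x *\<^sub>R k x"
      using AE_lborel_singleton[of 0] by eventually_elim (auto simp: indicator_def)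
    ultimately show ?thesis
      by (subst (asm) has_bochner_integral_cong_AE) (auto simp: k_def)
  qed
  have "has_bochner_integral lborel k (2 * (sqrt p / 2 * Beta (1 / 2) (p / 2)))"
    using has_bochner_integral_even_function[OF pos] by (simp add: k_def)
  hence "has_bochner_integral lborel (\<lambda>x. K * k x) (K * (2 * (sqrt p / 2 * Beta (1 / 2) (p / 2))))"
    by (rule has_bochner_integral_mult_right)
  also have "K * (2 * (sqrt p / 2 * Beta (1 / 2) (p / 2))) = 1"
  proof -
    have "K * (2 * (sqrt p / 2 * (sqrt pi * g / h))) = 1"
      if "g = Gamma (p / 2)" "h = Gamma ((p + 1) / 2)" "g > 0" "h > 0" for g h
      using that assms unfolding K_def that(1,2)[symmetric] by (simp add: real_sqrt_mult)
    moreover have "Beta (1 / 2) (p / 2) = sqrt pi * Gamma (p / 2) / Gamma ((p + 1) / 2)"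
      by (simp add: Beta_def Gamma_one_half_real add_divide_distrib add.commute)
    ultimately show ?thesis using assms by simp
  qed
  finally show "integrable lborel (student_density p)" "(LBINT x. student_density p x) = 1"
    unfolding dens by (auto simp: has_bochner_integral_iff)
qed

section \<open>Even functions with a single well\<close>

text \<open>
  Let \<open>H\<close> be the primitive of \<open>h\<close> vanishing at \<open>-\<infinity>\<close> and \<open>B\<close> the mass of \<open>h\<close> on each of the two outer
  rays, which is the same by symmetry. As the total mass is 0, the well carries mass \<open>- 2 * B\<close>. So \<open>H\<close>
  rises from 0 to \<open>B\<close>, falls to \<open>- B\<close> across the well, and rises back to 0.
\<close>
lemma
  fixes h :: "real \<Rightarrow> real"
  assumes int: "integrable lborel h" and zero: "(LBINT x. h x) = 0"
    and even: "\<And>x. h (- x) = h x" and a: "a \<ge> 0"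
    and inside: "\<And>x. \<bar>x\<bar> \<le> a \<Longrightarrow> h x \<le> 0"
    and outside: "\<And>x. \<bar>x\<bar> \<ge> a \<Longrightarrow> h x \<ge> 0"
  shows lbint_abs_single_well: "(LBINT x. \<bar>h x\<bar>) = -2 * (LBINT x:{-a..a}. h x)"
    and Sup_abs_primitive_single_well:
      "(SUP x. \<bar>LBINT u:{..x}. h u\<bar>) = - (LBINT x:{-a..a}. h x) / 2"
proof -
  have si: "set_integrable lborel A h" if "A \<in> sets borel" for A
    unfolding set_integrable_def by (rule integrable_mult_indicator) (use int that in auto)
  define I where "I = (LBINT x:{-a..a}. h x)"
  define B where "B = (LBINT x:{..-a}. h x)"
  define H where "H x = (LBINT u:{..x}. h u)" for x
  have reflect: "(LBINT x:{a..}. h x) = B"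
  proof -
    have "B = (LBINT x. indicator {..-a} (0 + (-1) * x) *\<^sub>R h (0 + (-1) * x))"
      unfolding B_def set_lebesgue_integral_def
      by (subst lborel_integral_real_affine[of "-1" _ 0]) auto
    also have "\<dots> = (LBINT x:{a..}. h x)"
      unfolding set_lebesgue_integral_def
      by (intro Bochner_Integration.integral_cong) (auto simp: indicator_def even)
    finally show ?thesis ..
  qed
  \<comment> \<open>Splitting at points costs nothing since they are null sets.\<close>
  have split: "(LBINT u:A \<union> A'. h u) = (LBINT u:A. h u) + (LBINT u:A'. h u)"
    if "A \<in> sets borel" "A' \<in> sets borel" "A \<inter> A' \<subseteq> {c}" for A A' c
  proof (rule set_integral_Un_AE)
    show "AE x in lborel. \<not> (x \<in> A \<and> x \<in> A')"
      using AE_lborel_singleton[of c] by eventually_elim (use that in auto)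
  qed (use that si in auto)
  have H_a: "H a = B + I"
  proof -
    have "{..-a} \<union> {-a..a} = {..a}" using a by auto
    moreover have "{..-a} \<inter> {-a..a} \<subseteq> {-a}" by auto
    ultimately show ?thesis using split[of "{..-a}" "{-a..a}" "-a"] unfolding H_def B_def I_def by simp
  qed
  have total: "(LBINT u:UNIV. h u) = H x + (LBINT u:{x..}. h u)" for x
  proof -
    have "{..x} \<union> {x..} = UNIV" by auto
    moreover have "{..x} \<inter> {x..} \<subseteq> {x}" by auto
    ultimately show ?thesis using split[of "{..x}" "{x..}" x] unfolding H_def by simp
  qed
  have BI: "2 * B + I = 0"
    using total[of a] reflect H_a zero by (simp add: set_lebesgue_integral_def)
  have mono: "(LBINT u:A. h u) \<le> (LBINT u:A'. h u)"
    if "A \<in> sets borel" "A' \<in> sets borel" "A \<subseteq> A'" "\<And>u. u \<in> A' - A \<Longrightarrow> h u \<ge> 0" for A A'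
    unfolding set_lebesgue_integral_def
    by (intro integral_mono; (use si that in \<open>simp add: set_integrable_def; fail\<close>)?)
       (use that in \<open>auto simp: indicator_def\<close>)
  have nn: "(LBINT u:A. h u) \<ge> 0" if "A \<in> sets borel" "\<And>u. u \<in> A \<Longrightarrow> h u \<ge> 0" for A
    using mono[of "{}" A] that by (simp add: set_lebesgue_integral_def)
  have np: "(LBINT u:A. h u) \<le> 0" if "A \<in> sets borel" "\<And>u. u \<in> A \<Longrightarrow> h u \<le> 0" for A
  proof -
    have "0 \<le> (LBINT u. - (indicator A u *\<^sub>R h u))"
      by (intro Bochner_Integration.integral_nonneg) (use that in \<open>auto simp: indicator_def\<close>)
    thus ?thesis by (simp add: set_lebesgue_integral_def)
  qed
  have B: "B \<ge> 0" unfolding B_def using a by (intro nn outside) auto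
  have bound: "\<bar>H x\<bar> \<le> B" for x
  proof -
    consider "x \<le> -a" | "x \<ge> a" | "-a \<le> x" "x \<le> a" by linarith
    thus ?thesis
    proof cases
      case 1
      have "H x \<ge> 0" unfolding H_def using 1 a by (intro nn outside) auto
      moreover have "H x \<le> B" unfolding H_def B_def using 1 a by (intro mono outside) auto
      ultimately show ?thesis by simp
    next
      case 2
      have "(LBINT u:{x..}. h u) \<ge> 0" using 2 a by (intro nn outside) auto
      moreover have "(LBINT u:{x..}. h u) \<le> B"
        unfolding reflect[symmetric] using 2 a by (intro mono outside) auto
      ultimately show ?thesis using total[of x] zero by (simp add: set_lebesgue_integral_def)
    next
      case 3
      have "H x = B + (LBINT u:{-a..x}. h u)"
      proof -
        have "{..-a} \<union> {-a..x} = {..x}" using 3 by auto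
        moreover have "{..-a} \<inter> {-a..x} \<subseteq> {-a}" by auto
        ultimately show ?thesis using split[of "{..-a}" "{-a..x}" "-a"] unfolding H_def B_def by simp
      qed
      moreover have "(LBINT u:{-a..x}. h u) \<le> 0" using 3 by (intro np inside) auto
      moreover have "I = (LBINT u:{-a..x}. h u) + (LBINT u:{x..a}. h u)"
      proof -
        have "{-a..x} \<union> {x..a} = {-a..a}" using 3 by auto
        moreover have "{-a..x} \<inter> {x..a} \<subseteq> {x}" by auto
        ultimately show ?thesis using split[of "{-a..x}" "{x..a}" x] unfolding I_def by simp
      qed
      moreover have "(LBINT u:{x..a}. h u) \<le> 0" using 3 by (intro np inside) auto
      ultimately show ?thesis using BI B by linarith
    qed
  qed
  have "(SUP x. \<bar>H x\<bar>) = B"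
  proof (rule antisym)
    show "(SUP x. \<bar>H x\<bar>) \<le> B" by (intro cSUP_least bound) auto
    have "\<bar>H a\<bar> \<le> (SUP x. \<bar>H x\<bar>)" by (intro cSUP_upper bdd_aboveI2[where M = B] bound) auto
    thus "B \<le> (SUP x. \<bar>H x\<bar>)" using H_a BI B by simp
  qed
  thus "(SUP x. \<bar>LBINT u:{..x}. h u\<bar>) = - (LBINT x:{-a..a}. h x) / 2"
    using BI unfolding H_def I_def by simp
  have "(LBINT x. \<bar>h x\<bar>) = (LBINT x. h x + 2 * (indicator {-a..a} x * (- h x)))"
  proof (intro Bochner_Integration.integral_cong refl)
    fix x
    show "\<bar>h x\<bar> = h x + 2 * (indicator {-a..a} x * (- h x))"
      using inside[of x] outside[of x] by (cases "\<bar>x\<bar> \<le> a") (auto simp: indicator_def abs_le_iff)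
  qed
  also have "\<dots> = (LBINT x. h x) + (LBINT x. 2 * (indicator {-a..a} x * (- h x)))"
    using int si[of "{-a..a}"] by (intro Bochner_Integration.integral_add) (auto simp: set_integrable_def)
  also have "\<dots> = -2 * (LBINT x:{-a..a}. h x)"
    using zero by (simp add: set_lebesgue_integral_def)
  finally show "(LBINT x. \<bar>h x\<bar>) = -2 * (LBINT x:{-a..a}. h x)" .
qed

text \<open>
  The well is the interval of negativity, so no other set can carry less mass.
\<close>
lemma integral_single_well_le:
  fixes h :: "real \<Rightarrow> real"
  assumes int: "integrable lborel h"
    and inside: "\<And>x. \<bar>x\<bar> \<le> a \<Longrightarrow> h x \<le> 0"
    and outside: "\<And>x. \<bar>x\<bar> \<ge> a \<Longrightarrow> h x \<ge> 0"
    and A: "A \<in> sets borel"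
  shows "(LBINT x:{-a..a}. h x) \<le> (LBINT x:A. h x)"
  unfolding set_lebesgue_integral_def
proof (rule integral_mono)
  show "indicator {-a..a} x *\<^sub>R h x \<le> indicator A x *\<^sub>R h x" for x
    using inside[of x] outside[of x] by (cases "\<bar>x\<bar> \<le> a") (auto simp: indicator_def abs_le_iff)
qed (use int A in \<open>auto intro!: integrable_mult_indicator simp del: real_scaleR_def\<close>)

lemma set_integral_FTC_symmetric:
  fixes F g :: "real \<Rightarrow> real"
  assumes "a \<ge> 0" and "\<And>x. (F has_real_derivative g x) (at x)" and "\<And>x. isCont g x"
  shows "set_integrable lborel {-a..a} g" and "(LBINT x:{-a..a}. g x) = F a - F (-a)"
  using has_bochner_integral_FTC_Icc_real[of "-a" a F g] assms
  by (auto simp: set_integrable_def set_lebesgue_integral_def has_bochner_integral_iff mult.commute)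

section \<open>The quotient of the two densities\<close>

abbreviation \<phi> :: "real \<Rightarrow> real" where "\<phi> \<equiv> std_normal_density"

definition kernel_ratio :: "real \<Rightarrow> real \<Rightarrow> real" where
  "kernel_ratio p u = exp (u / 2) * (1 + u / p) powr (- (p + 1) / 2)"

lemma kernel_ratio_pos: "p > 0 \<Longrightarrow> u \<ge> 0 \<Longrightarrow> kernel_ratio p u > 0"
  using add_pos_nonneg[of 1 "u / p"] by (simp add: kernel_ratio_def)

lemma student_density_eq:
  assumes "p > 0"
  shows "student_density p x = \<phi> x * (gamma_ratio p * kernel_ratio p (x\<^sup>2))"
proof -
  have "sqrt (pi * p) = sqrt (2 * pi) * sqrt (p / 2)"
    by (simp flip: real_sqrt_mult)
  moreover have "exp (- x\<^sup>2 / 2) * exp (x\<^sup>2 / 2) = 1"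
    by (simp flip: exp_add)
  ultimately show ?thesis
    unfolding student_density_def std_normal_density_def gamma_ratio_def kernel_ratio_def
    by (simp add: field_simps)
qed

lemma kernel_ratio_deriv:
  assumes "p > 0" "u \<ge> 0"
  shows "(kernel_ratio p has_real_derivative (u - 1) / (2 * (p + u)) * kernel_ratio p u) (at u)"
proof -
  have pos: "1 + u / p > 0" using assms by (intro add_pos_nonneg) auto
  have *: "(1 + u / p) powr (- (p + 1) / 2 - 1) = (1 + u / p) powr (- (p + 1) / 2) / (1 + u / p)"
    using pos by (simp only: powr_diff powr_one)
  have "((\<lambda>u. exp (u / 2) * (1 + u / p) powr (- (p + 1) / 2)) has_real_derivative
     (exp (u / 2) * (1 / 2) * (1 + u / p) powr (- (p + 1) / 2) +
      exp (u / 2) * (- (p + 1) / 2 * (1 + u / p) powr (- (p + 1) / 2 - 1) * (1 / p)))) (at u)"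
    using pos assms by (auto intro!: derivative_eq_intros simp: mult_ac)
  also have "exp (u / 2) * (1 / 2) * (1 + u / p) powr (- (p + 1) / 2) +
      exp (u / 2) * (- (p + 1) / 2 * (1 + u / p) powr (- (p + 1) / 2 - 1) * (1 / p))
    = (1 / 2 - (p + 1) / (2 * p) / (1 + u / p)) * kernel_ratio p u"
  proof -
    have "E * (1 / 2) * P + E * (- (p + 1) / 2 * (P / A) * (1 / p))
        = (1 / 2 - (p + 1) / (2 * p) / A) * (E * P)" if "A > 0" for E P A :: real
      using that assms(1) by (simp add: field_simps)
    thus ?thesis unfolding * kernel_ratio_def using pos .
  qed
  also have "1 / 2 - (p + 1) / (2 * p) / (1 + u / p) = (u - 1) / (2 * (p + u))"
    using assms by (simp add: divide_simps) (simp add: algebra_simps)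
  finally show ?thesis unfolding kernel_ratio_def [abs_def] .
qed

lemma kernel_ratio_antimono:
  assumes "p > 0" "0 \<le> u" "u \<le> v" "v \<le> 1"
  shows "kernel_ratio p v \<le> kernel_ratio p u"
proof (rule DERIV_nonpos_imp_nonincreasing[OF assms(3)])
  fix x assume x: "u \<le> x" "x \<le> v"
  have "(x - 1) / (2 * (p + x)) * kernel_ratio p x \<le> 0"
    using x assms kernel_ratio_pos[of p x] by (intro mult_nonpos_nonneg divide_nonpos_pos) auto
  with kernel_ratio_deriv[of p x] x assms
  show "\<exists>y. (kernel_ratio p has_real_derivative y) (at x) \<and> y \<le> 0" by auto
qed

lemma kernel_ratio_mono:
  assumes "p > 0" "1 \<le> u" "u \<le> v"
  shows "kernel_ratio p u \<le> kernel_ratio p v"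
proof (rule DERIV_nonneg_imp_nondecreasing[OF assms(3)])
  fix x assume x: "u \<le> x" "x \<le> v"
  have "(x - 1) / (2 * (p + x)) * kernel_ratio p x \<ge> 0"
    using x assms kernel_ratio_pos[of p x] by (intro mult_nonneg_nonneg divide_nonneg_pos) auto
  with kernel_ratio_deriv[of p x] x assms
  show "\<exists>y. (kernel_ratio p has_real_derivative y) (at x) \<and> y \<ge> 0" by auto
qed

text \<open>
  Both factors are bounded by exponentials whose exponents add up to
  \<open>t * (u\<^sup>2 - 2 * u - 1) / 4 + t\<^sup>2 * (2 + u\<^sup>2) / 4\<close> with \<open>t = 1 / p\<close>; the constant 5 absorbs the second
  summand and the quadratic term of the exponential series.
\<close>
lemma density_ratio_le:
  assumes "p \<ge> 4" "0 \<le> u" "u \<le> 3"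
  shows "gamma_ratio p * kernel_ratio p u \<le> 1 + (u\<^sup>2 - 2 * u - 1) / (4 * p) + 5 / p\<^sup>2"
proof -
  define t where "t = 1 / p"
  have t: "0 < t" "t \<le> 1 / 4" "p = 1 / t" using assms by (auto simp: t_def field_simps)
  define q where "q = u\<^sup>2 - 2 * u - 1"
  have u2: "u\<^sup>2 \<le> 9" using power_mono[OF assms(3,2), of 2] by simp
  have q: "\<bar>q\<bar> \<le> 2"
  proof -
    have "(u - 1)\<^sup>2 \<le> 2\<^sup>2" using assms by (intro abs_le_square_iff[THEN iffD1]) (auto simp: abs_le_iff)
    hence "q \<le> 2" by (simp add: q_def power2_eq_square algebra_simps)
    moreover have "q = (u - 1)\<^sup>2 - 2" by (simp add: q_def power2_eq_square algebra_simps)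
    hence "q \<ge> -2" by simp
    ultimately show ?thesis by simp
  qed
  define y where "y = t * q / 4 + t\<^sup>2 * (2 + u\<^sup>2) / 4"
  have pos: "1 + u / p > 0" using assms by (intro add_pos_nonneg) auto
  have "kernel_ratio p u = exp (u / 2 - (p + 1) / 2 * ln (1 + u / p))"
  proof -
    have "u / 2 - (p + 1) / 2 * ln (1 + u / p) = u / 2 + - (p + 1) / 2 * ln (1 + u / p)"
      by (simp only: minus_divide_left[symmetric] minus_mult_left[symmetric] diff_conv_add_uminus)
    thus ?thesis using pos by (simp only: exp_add) (simp add: kernel_ratio_def powr_def)
  qed
  also have "\<dots> \<le> exp (u / 2 - (p + 1) / 2 * (u / p - (u / p)\<^sup>2 / 2))"
    using ln_one_plus_ge[of "u / p"] assms by (auto intro!: mult_left_mono)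
  finally have "gamma_ratio p * kernel_ratio p u
     \<le> exp (- (1 / (4 * p)) + 1 / (2 * p\<^sup>2)) * exp (u / 2 - (p + 1) / 2 * (u / p - (u / p)\<^sup>2 / 2))"
    using gamma_ratio_le_exp[of p] kernel_ratio_pos[of p u] assms
    by (intro mult_mono) auto
  also have "\<dots> = exp (- (1 / (4 * p)) + 1 / (2 * p\<^sup>2) + (u / 2 - (p + 1) / 2 * (u / p - (u / p)\<^sup>2 / 2)))"
    by (simp only: exp_add)
  also have "- (1 / (4 * p)) + 1 / (2 * p\<^sup>2) + (u / 2 - (p + 1) / 2 * (u / p - (u / p)\<^sup>2 / 2))
     = t * q / 4 + t\<^sup>2 * (2 + u\<^sup>2) / 4 - 0"
    unfolding q_def t(3) using t(1) by (simp add: field_simps power2_eq_square)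
  finally have le_exp: "gamma_ratio p * kernel_ratio p u \<le> exp y" by (simp add: y_def)
  have "\<bar>y\<bar> \<le> 19 / 16 * t"
  proof -
    have "t * \<bar>q\<bar> \<le> t * 2" using q t by (intro mult_left_mono) auto
    hence "\<bar>t * q / 4\<bar> \<le> t / 2" using t by (simp add: abs_mult)
    have "t * (t * (2 + u\<^sup>2)) \<le> t * (1 / 4 * 11)"
      using t u2 by (intro mult_left_mono mult_mono) auto
    moreover have "t * (t * (2 + u\<^sup>2)) = t\<^sup>2 * (2 + u\<^sup>2)"
      by (simp only: power2_eq_square mult.assoc)
    ultimately have "t\<^sup>2 * (2 + u\<^sup>2) / 4 \<le> 11 / 16 * t" by linarith
    moreover have "t\<^sup>2 * (2 + u\<^sup>2) / 4 \<ge> 0" by simp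
    ultimately show ?thesis using \<open>\<bar>t * q / 4\<bar> \<le> t / 2\<close> unfolding y_def by linarith
  qed
  hence y: "\<bar>y\<bar> \<le> 3 / 2 * t" using t by simp
  hence "y \<le> 1" using t by linarith
  moreover have "y\<^sup>2 \<le> 9 / 4 * t\<^sup>2"
    using power_mono[OF y, of 2] by (simp add: power_mult_distrib power_divide)
  ultimately have "exp y \<le> 1 + y + 9 / 4 * t\<^sup>2" using exp_le_quadratic[of y] by simp
  moreover have "y \<le> t * q / 4 + t\<^sup>2 * 11 / 4"
    unfolding y_def using u2 by (auto intro!: mult_left_mono divide_right_mono)
  ultimately have "gamma_ratio p * kernel_ratio p u \<le> 1 + t * q / 4 + 5 * t\<^sup>2"
    using le_exp by simp
  thus ?thesis by (simp add: t_def q_def power_divide)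
qed

section \<open>A polynomial minorant of the quotient\<close>

text \<open>
  For \<open>t = 1 / p\<close>, the difference of the normal and the Student distribution function has the expansion
  \<open>\<phi> x * x * (t * (1 + u) / 4 - t\<^sup>2 * (3 + 5 * u + 7 * u\<^sup>2 - 3 * u\<^sup>3) / 96 + O(t\<^sup>3))\<close> with \<open>u = x\<^sup>2\<close>. The part
  of the correction not involving \<open>t\<close> is the cubic that is subtracted with the factor \<open>t\<^sup>2\<close>. It equals
  \<open>(3 - u) * (3 * u\<^sup>2 + 2 * u + 1) / 96\<close>, which is why 3 is the natural bound for \<open>u\<close>. In the part
  proportional to \<open>t\<close>, the constant coefficient makes the minorant at \<open>u = 0\<close> the cubic Taylor
  polynomial of \<open>exp (- t / 4)\<close>. The other three coefficients stem from a numerical search: they leave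
  the correction positive up to \<open>u = 3\<close> and satisfy the two quintic inequalities below.
\<close>
definition correction :: "real \<Rightarrow> real \<Rightarrow> real" where
  "correction t u = (12 + 20 * u + 28 * u^2 - 12 * u^3 + t * (- 1 - 5 * u - 35 * u^2 + 14 * u^3)) / 384"

definition correction' :: "real \<Rightarrow> real \<Rightarrow> real" where
  "correction' t u = (20 + 56 * u - 36 * u^2 + t * (- 5 - 70 * u + 42 * u^2)) / 384"

lemma correction_deriv: "(correction t has_real_derivative correction' t u) (at u)"
proof -
  have "((\<lambda>u. (12 + 20 * u + 28 * u^2 - 12 * u^3 + t * (- 1 - 5 * u - 35 * u^2 + 14 * u^3)) / 384)
    has_real_derivative (20 + 28 * (2 * u) - 12 * (3 * u^2) + t * (- 5 - 35 * (2 * u) + 14 * (3 * u^2))) / 384) (at u)"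
    by (auto intro!: derivative_eq_intros)
  thus ?thesis unfolding correction_def [abs_def] correction'_def by simp
qed

text \<open>
  Being affine in \<open>t\<close>, the correction is a convex combination of its values at \<open>t = 0\<close> and
  \<open>t = 1 / 4\<close>.
\<close>
lemma correction_pos:
  assumes "0 < t" "t \<le> 1 / 4" "0 \<le> u" "u \<le> 3"
  shows "correction t u > 0"
proof -
  have 1: "(3 - u) * (12 * u\<^sup>2 + 8 * u + 4) \<ge> 0" using assms by simp
  have "u * u * (3 - u) \<ge> 0" "u * (3 - u) \<ge> 0" using assms by simp_all
  hence "47 + 75 * u + 77 * u^2 - 34 * u^3 > 0" using assms
    by (simp add: power2_eq_square power3_eq_cube algebra_simps)
  hence "t * (47 + 75 * u + 77 * u^2 - 34 * u^3) > 0" using assms by simp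
  moreover have "(1 - 4 * t) * ((3 - u) * (12 * u\<^sup>2 + 8 * u + 4)) \<ge> 0"
    using assms 1 by (intro mult_nonneg_nonneg) auto
  moreover have "384 * correction t u = (1 - 4 * t) * ((3 - u) * (12 * u\<^sup>2 + 8 * u + 4))
      + t * (47 + 75 * u + 77 * u^2 - 34 * u^3)"
  proof -
    have "384 * correction t u = 12 + 20 * u + 28 * u^2 - 12 * u^3 + t * (- 1 - 5 * u - 35 * u^2 + 14 * u^3)"
      unfolding correction_def by simp
    thus ?thesis by (simp add: algebra_simps power2_eq_square power3_eq_cube)
  qed
  ultimately show ?thesis by linarith
qed

text \<open>
  The combination in the last summand is forced by the product rule: the derivative of
  \<open>\<phi> x * x * m (x\<^sup>2)\<close> is \<open>\<phi> x * (m u + 2 * u * m' u - u * m u)\<close> with \<open>u = x\<^sup>2\<close>.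
\<close>
definition minorant :: "real \<Rightarrow> real \<Rightarrow> real" where
  "minorant t u = 1 + t * (u\<^sup>2 - 2 * u - 1) / 4 + t\<^sup>2 * (correction t u + 2 * u * correction' t u - u * correction t u)"

lemma minorant_poly:
  "minorant t u = 1 + t * (u\<^sup>2 - 2 * u - 1) / 4 +
     t^2 * ((12 + 48 * u + 120 * u^2 - 112 * u^3 + 12 * u^4)
        + t * (- 1 - 14 * u - 170 * u^2 + 133 * u^3 - 14 * u^4)) / 384"
proof -
  have "384 * (correction t u + 2 * u * correction' t u - u * correction t u)
    = 384 * correction t u + 2 * u * (384 * correction' t u) - u * (384 * correction t u)" by (simp add: algebra_simps)
  also have "384 * correction t u = 12 + 20 * u + 28 * u^2 - 12 * u^3 + t * (- 1 - 5 * u - 35 * u^2 + 14 * u^3)"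
    by (simp add: correction_def)
  also have "384 * correction' t u = 20 + 56 * u - 36 * u^2 + t * (- 5 - 70 * u + 42 * u^2)"
    by (simp add: correction'_def)
  finally have *: "correction t u + 2 * u * correction' t u - u * correction t u
    = (12 + 48 * u + 120 * u^2 - 112 * u^3 + 12 * u^4
        + t * (- 1 - 14 * u - 170 * u^2 + 133 * u^3 - 14 * u^4)) / 384"
    by (simp add: algebra_simps eval_nat_numeral)
  show ?thesis unfolding minorant_def * by simp
qed

definition minorant' :: "real \<Rightarrow> real \<Rightarrow> real" where
  "minorant' t u = t * (2 * u - 2) / 4 +
     t^2 * ((48 + 240 * u - 336 * u^2 + 48 * u^3)
        + t * (- 14 - 340 * u + 399 * u^2 - 56 * u^3)) / 384"

lemma minorant_deriv: "(minorant t has_real_derivative minorant' t u) (at u)"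
proof -
  have "((\<lambda>u. 1 + t * (u\<^sup>2 - 2 * u - 1) / 4 +
     t^2 * ((12 + 48 * u + 120 * u^2 - 112 * u^3 + 12 * u^4)
        + t * (- 1 - 14 * u - 170 * u^2 + 133 * u^3 - 14 * u^4)) / 384)
     has_real_derivative
     (t * (2 * u - 2) / 4 +
     t^2 * ((48 + 120 * (2 * u) - 112 * (3 * u^2) + 12 * (4 * u^3))
        + t * (- 14 - 170 * (2 * u) + 133 * (3 * u^2) - 14 * (4 * u^3))) / 384)) (at u)"
    by (auto intro!: derivative_eq_intros)
  thus ?thesis unfolding minorant_poly [abs_def] minorant'_def by simp
qed

text \<open>
  On \<open>[0, 1]\<close> the quintic is a positive combination of the Bernstein monomials \<open>u\<^sup>i * (1 - u)\<^sup>j\<close> with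
  \<open>i + j = 5\<close>; on \<open>[1, 3]\<close> it is expanded at 1.
\<close>
lemma quintic_0_pos:
  fixes u :: real
  assumes "0 \<le> u" "u \<le> 3"
  shows "16 + 548 * u - 1350 * u^2 + 1016 * u^3 - 220 * u^4 + 12 * u^5 > 0"
proof (cases "u \<le> 1")
  case True
  define v where "v = 1 - u"
  have "u^5 \<ge> 0" "v^5 \<ge> 0" "u * v^4 \<ge> 0" "u^2 * v^3 \<ge> 0" "u^3 * v^2 \<ge> 0" "u^4 * v \<ge> 0"
    using assms True by (simp_all add: v_def)
  moreover have "u^5 > 0 \<or> v^5 > 0" using assms True by (cases "u = 0") (auto simp: v_def)
  ultimately have "16 * v^5 + 628 * (u * v^4) + 1002 * (u^2 * v^3) + 414 * (u^3 * v^2) + 34 * (u^4 * v) + 22 * u^5 > 0"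
    by linarith
  thus ?thesis unfolding v_def by (simp add: algebra_simps eval_nat_numeral)
next
  case False
  define s where "s = u - 1"
  have s: "0 < s" "s \<le> 2" using assms False by (simp_all add: s_def)
  have "s ^ 3 * s \<le> s ^ 3 * 2" "s ^ 2 * s \<le> s ^ 2 * 2"
    by (rule mult_left_mono; use s in simp)+
  hence le: "s ^ 4 \<le> 2 * s ^ 3" "s ^ 3 \<le> 2 * s ^ 2" by (simp_all add: eval_nat_numeral mult_ac)
  have pos: "s ^ 5 > 0" "s ^ 2 > 0" using s by simp_all
  have "22 + 76 * s + 498 * s^2 + 256 * s^3 - 160 * s^4 + 12 * s^5 > 0"
    using s le pos by linarith
  thus ?thesis unfolding s_def by (simp add: algebra_simps eval_nat_numeral)
qed

lemma quintic_quarter_pos: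
  fixes u :: real
  assumes "0 \<le> u" "u \<le> 3"
  shows "65 + 2233 * u - 4564 * u^2 + 2963 * u^3 - 621 * u^4 + 34 * u^5 > 0"
proof (cases "u \<le> 1")
  case True
  define v where "v = 1 - u"
  have "u^5 \<ge> 0" "v^5 \<ge> 0" "u * v^4 \<ge> 0" "u^2 * v^3 \<ge> 0" "u^3 * v^2 \<ge> 0" "u^4 * v \<ge> 0"
    using assms True by (simp_all add: v_def)
  moreover have "u^5 > 0 \<or> v^5 > 0" using assms True by (cases "u = 0") (auto simp: v_def)
  ultimately have "65 * v^5 + 2558 * (u * v^4) + 5018 * (u^2 * v^3) + 3319 * (u^3 * v^2) + 870 * (u^4 * v) + 110 * u^5 > 0"
    by linarith
  thus ?thesis unfolding v_def by (simp add: algebra_simps eval_nat_numeral)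
next
  case False
  define s where "s = u - 1"
  have s: "0 < s" "s \<le> 2" using assms False by (simp_all add: s_def)
  have "s ^ 3 * s \<le> s ^ 3 * 2" "s ^ 2 * s \<le> s ^ 2 * 2"
    by (rule mult_left_mono; use s in simp)+
  hence le: "s ^ 4 \<le> 2 * s ^ 3" "s ^ 3 \<le> 2 * s ^ 2" by (simp_all add: eval_nat_numeral mult_ac)
  have pos: "s ^ 5 > 0" "s ^ 2 > 0" using s by simp_all
  have "(2 * s - 1)^2 \<ge> 0" by simp
  hence "4 * s ^ 2 - 4 * s + 1 \<ge> 0" by (simp add: power2_eq_square algebra_simps)
  hence "110 - 320 * s + 939 * s^2 + 819 * s^3 - 451 * s^4 + 34 * s^5 > 0"
    using s le pos by linarith
  thus ?thesis unfolding s_def by (simp add: algebra_simps eval_nat_numeral)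
qed

text \<open>
  After clearing denominators, this is the comparison of the logarithmic derivative of the minorant
  with that of \<open>kernel_ratio\<close>. The minorant is accurate to second order in \<open>t\<close>, so a factor \<open>t\<^sup>3\<close> splits
  off, and what remains is affine in \<open>t\<close>. It suffices to look at \<open>t = 0\<close> and \<open>t = 1 / 4\<close>, which yields
  the two quintics.
\<close>
lemma minorant_log_deriv_le:
  assumes "0 < t" "t \<le> 1 / 4" "0 \<le> u" "u \<le> 3"
  shows "2 * (1 + t * u) * minorant' t u \<le> t * (u - 1) * minorant t u"
proof -
  have "0 \<le> t^3 * ((1 - 4 * t) * (16 + 548 * u - 1350 * u^2 + 1016 * u^3 - 220 * u^4 + 12 * u^5)
      + t * (65 + 2233 * u - 4564 * u^2 + 2963 * u^3 - 621 * u^4 + 34 * u^5))"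
    using assms quintic_0_pos[of u, THEN less_imp_le] quintic_quarter_pos[of u, THEN less_imp_le]
    by (intro mult_nonneg_nonneg add_nonneg_nonneg[of "(1 - 4 * t) * _" "t * _"]) simp_all
  also have "\<dots> = 384 * (t * (u - 1) * minorant t u - 2 * (1 + t * u) * minorant' t u)"
  proof -
    have L: "384 * minorant t u = 384 + 96 * t * (u\<^sup>2 - 2 * u - 1) +
     t^2 * ((12 + 48 * u + 120 * u^2 - 112 * u^3 + 12 * u^4)
        + t * (- 1 - 14 * u - 170 * u^2 + 133 * u^3 - 14 * u^4))"
      unfolding minorant_poly by simp
    have L': "384 * minorant' t u = 96 * t * (2 * u - 2) +
     t^2 * ((48 + 240 * u - 336 * u^2 + 48 * u^3)
        + t * (- 14 - 340 * u + 399 * u^2 - 56 * u^3))"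
      unfolding minorant'_def by simp
    have "384 * (t * (u - 1) * minorant t u - 2 * (1 + t * u) * minorant' t u)
      = t * (u - 1) * (384 * minorant t u) - 2 * (1 + t * u) * (384 * minorant' t u)"
      by (simp add: algebra_simps)
    thus ?thesis unfolding L L' by (simp add: algebra_simps eval_nat_numeral)
  qed
  finally show ?thesis by simp
qed

lemma minorant_le_kernel_ratio:
  assumes "p \<ge> 4" "0 \<le> u" "u \<le> 3"
  shows "minorant (1 / p) u \<le> minorant (1 / p) 0 * kernel_ratio p u"
proof -
  have "minorant (1 / p) u / kernel_ratio p u \<le> minorant (1 / p) 0 / kernel_ratio p 0"
  proof (rule DERIV_nonpos_imp_nonincreasing[OF assms(2)])
    fix x assume x: "0 \<le> x" "x \<le> u"
    have pos: "kernel_ratio p x > 0" using assms x by (intro kernel_ratio_pos) auto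
    let ?k = "kernel_ratio p x" and ?c = "(x - 1) / (2 * (p + x))"
    have "((\<lambda>u. minorant (1 / p) u / kernel_ratio p u) has_real_derivative
       (minorant' (1 / p) x * ?k - minorant (1 / p) x * (?c * ?k)) / (?k * ?k)) (at x)"
      using assms x pos by (intro DERIV_divide minorant_deriv kernel_ratio_deriv) auto
    also have "(minorant' (1 / p) x * ?k - minorant (1 / p) x * (?c * ?k)) / (?k * ?k)
      = (minorant' (1 / p) x - minorant (1 / p) x * ?c) / ?k"
      using pos by (simp add: field_simps)
    finally have D: "((\<lambda>u. minorant (1 / p) u / kernel_ratio p u) has_real_derivative \<dots>) (at x)" .
    have "2 * (1 + (1 / p) * x) * minorant' (1 / p) x \<le> (1 / p) * (x - 1) * minorant (1 / p) x"
      using assms x by (intro minorant_log_deriv_le) auto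
    hence "p * (2 * (1 + (1 / p) * x) * minorant' (1 / p) x) \<le> p * ((1 / p) * (x - 1) * minorant (1 / p) x)"
      using assms by (intro mult_left_mono) auto
    also have "p * ((1 / p) * (x - 1) * minorant (1 / p) x) = minorant (1 / p) x * (x - 1)"
      using assms by simp
    also have "p * (2 * (1 + (1 / p) * x) * minorant' (1 / p) x) = minorant' (1 / p) x * (2 * (p + x))"
      using assms by (simp add: field_simps)
    finally have "minorant' (1 / p) x * (2 * (p + x)) \<le> minorant (1 / p) x * (x - 1)" .
    hence "minorant' (1 / p) x \<le> minorant (1 / p) x * ?c"
      using assms x by (simp add: pos_le_divide_eq)
    hence "(minorant' (1 / p) x - minorant (1 / p) x * ?c) / ?k \<le> 0"
      using pos by (simp add: divide_nonpos_pos)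
    with D show "\<exists>y. ((\<lambda>u. minorant (1 / p) u / kernel_ratio p u) has_real_derivative y) (at x) \<and> y \<le> 0"
      by blast
  qed
  thus ?thesis using kernel_ratio_pos[of p u] assms by (simp add: kernel_ratio_def[of p 0] field_simps)
qed

lemma minorant_0_le_exp: "minorant t 0 \<le> exp (- t / 4)"
proof -
  have "minorant t 0 = 1 + (- t / 4) + (- t / 4)\<^sup>2 / 2 + (- t / 4) ^ 3 / 6"
    unfolding minorant_poly by (simp add: power2_eq_square power3_eq_cube field_simps)
  thus ?thesis using exp_ge_cubic[of "- t / 4"] by simp
qed

lemma minorant_le_density_ratio:
  assumes "p \<ge> 4" "0 \<le> u" "u \<le> 3"
  shows "minorant (1 / p) u \<le> gamma_ratio p * kernel_ratio p u"
proof -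
  have "minorant (1 / p) 0 \<le> gamma_ratio p"
    using minorant_0_le_exp[of "1 / p"] gamma_ratio_ge[of p] assms by (simp add: mult.commute)
  hence "minorant (1 / p) 0 * kernel_ratio p u \<le> gamma_ratio p * kernel_ratio p u"
    using kernel_ratio_pos[of p u] assms by (intro mult_right_mono) auto
  with minorant_le_kernel_ratio[OF assms] show ?thesis by linarith
qed

lemma minorant_3:
  assumes "0 < t" "t \<le> 1 / 4"
  shows "minorant t 3 > 1"
proof -
  have "192 - 816 * t + 884 * t\<^sup>2 = 884 * (t - 6 / 13)\<^sup>2 + 48 / 13"
    by (simp add: power2_eq_square field_simps)
  also have "\<dots> > 0" by (intro add_nonneg_pos) auto
  finally have "192 - 816 * t + 884 * t\<^sup>2 > 0" .
  hence "t * (192 - 816 * t + 884 * t\<^sup>2) > 0" using assms by simp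
  moreover have "384 * minorant t 3 = 384 + t * (192 - 816 * t + 884 * t\<^sup>2)"
  proof -
    have "384 * minorant t 3 = 384 + 192 * t + t\<^sup>2 * (t * 884 - 816)"
      by (simp add: minorant_poly)
    thus ?thesis by (simp add: power2_eq_square algebra_simps)
  qed
  ultimately show ?thesis by linarith
qed

section \<open>The two distances as one integral\<close>

text \<open>
  The quotient is below 1 at \<open>u = 0\<close>, hence on \<open>[0, 1]\<close>, where it decreases. It exceeds 1 at
  \<open>u = 3\<close>, because the minorant does, and increases on \<open>[1, \<infinity>)\<close>; so it crosses 1 once in between.
\<close>
lemma density_ratio_crossing:
  assumes "p \<ge> 4"
  obtains a where "0 < a" "a\<^sup>2 \<le> 3"
    "\<And>x. \<bar>x\<bar> \<le> a \<Longrightarrow> student_density p x \<le> \<phi> x"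
    "\<And>x. \<bar>x\<bar> \<ge> a \<Longrightarrow> student_density p x \<ge> \<phi> x"
proof -
  define r where "r u = gamma_ratio p * kernel_ratio p u" for u
  have p: "p > 0" using assms by simp
  have anti: "r v \<le> r u" if "0 \<le> u" "u \<le> v" "v \<le> 1" for u v
    unfolding r_def using kernel_ratio_antimono[OF p that] gamma_ratio_pos[OF p]
    by (intro mult_left_mono) auto
  have mono: "r u \<le> r v" if "1 \<le> u" "u \<le> v" for u v
    unfolding r_def using kernel_ratio_mono[OF p that] gamma_ratio_pos[OF p]
    by (intro mult_left_mono) auto
  have "r 0 < 1" using gamma_ratio_less_1[OF p] by (simp add: r_def kernel_ratio_def)
  have "r 1 \<le> 1" using anti[of 0 1] \<open>r 0 < 1\<close> by simp
  have "r 3 > 1" using minorant_le_density_ratio[of p 3] minorant_3[of "1 / p"] assms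
    by (simp add: r_def field_simps)
  have "continuous_on {1..3} r" unfolding r_def
    by (intro continuous_intros DERIV_continuous_on[of _ _ "\<lambda>u. (u - 1) / (2 * (p + u)) * kernel_ratio p u"]
          DERIV_subset[OF kernel_ratio_deriv]) (use p in auto)
  then obtain v where v: "1 \<le> v" "v \<le> 3" "r v = 1"
    using IVT'[of r 1 1 3] \<open>r 1 \<le> 1\<close> \<open>r 3 > 1\<close> by auto
  have le: "r u \<le> 1" if "0 \<le> u" "u \<le> v" for u
    using anti[of 0 u] mono[of u v] \<open>r 0 < 1\<close> v that by (cases "u \<le> 1") auto
  have ge: "r u \<ge> 1" if "v \<le> u" for u
    using mono[of v u] v that by simp
  have dens: "student_density p x = \<phi> x * r (x\<^sup>2)" for x
    using student_density_eq[OF p] by (simp add: r_def)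
  show thesis
  proof (rule that[of "sqrt v"])
    show "sqrt v > 0" "(sqrt v)\<^sup>2 \<le> 3" using v by simp_all
    fix x
    show "student_density p x \<le> \<phi> x" if "\<bar>x\<bar> \<le> sqrt v"
    proof -
      have "x\<^sup>2 \<le> v" using that v power_mono[OF that, of 2] by simp
      hence "\<phi> x * r (x\<^sup>2) \<le> \<phi> x * 1" by (intro mult_left_mono le) auto
      thus ?thesis by (simp add: dens)
    qed
    show "student_density p x \<ge> \<phi> x" if "\<bar>x\<bar> \<ge> sqrt v"
    proof -
      have "x\<^sup>2 \<ge> v" using that v power_mono[OF that, of 2] by simp
      hence "\<phi> x * r (x\<^sup>2) \<ge> \<phi> x * 1" by (intro mult_left_mono ge) auto
      thus ?thesis by (simp add: dens)
    qed
  qed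
qed

lemma cdf_std_normal: "cdf std_normal_distribution x = (LBINT u:{..x}. \<phi> u)"
proof -
  interpret prob_space std_normal_distribution by (rule prob_space_normal_density) simp
  have "cdf std_normal_distribution x = (\<integral>u. indicator {..x} u \<partial>std_normal_distribution)"
    by (simp add: cdf_def)
  also have "\<dots> = (LBINT u:{..x}. \<phi> u)"
    unfolding set_lebesgue_integral_def
    by (subst integral_density) (auto simp: mult.commute)
  finally show ?thesis .
qed

lemma integrable_density_diff:
  assumes "p > 0"
  shows "integrable lborel (\<lambda>x. \<phi> x - student_density p x)"
  using integrable_student_density[OF assms] by (intro Bochner_Integration.integrable_diff) auto

lemma
  assumes "p \<ge> 4"
  shows half_d_TV_eq_d_Ko: "1 / 2 * d_TV p = d_Ko p"
    and d_Ko_well: "\<exists>a>0. a\<^sup>2 \<le> 3 \<and> 2 * d_Ko p = (LBINT x:{-a..a}. \<phi> x - student_density p x)"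
    and d_Ko_ge: "\<And>b. (LBINT x:{-b..b}. \<phi> x - student_density p x) \<le> 2 * d_Ko p"
proof -
  have p: "p > 0" using assms by simp
  define h where "h x = student_density p x - \<phi> x" for x
  have int: "integrable lborel h" unfolding h_def
    using integrable_student_density[OF p] by (intro Bochner_Integration.integrable_diff) auto
  have zero: "(LBINT x. h x) = 0" unfolding h_def
    using integrable_student_density[OF p] integral_student_density[OF p]
    by (subst Bochner_Integration.integral_diff) auto
  have even: "h (- x) = h x" for x
    by (simp add: h_def student_density_even std_normal_density_def)
  obtain a where a: "0 < a" "a\<^sup>2 \<le> 3"
    "\<And>x. \<bar>x\<bar> \<le> a \<Longrightarrow> student_density p x \<le> \<phi> x"
    "\<And>x. \<bar>x\<bar> \<ge> a \<Longrightarrow> student_density p x \<ge> \<phi> x"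
    by (rule density_ratio_crossing[OF assms]) blast
  have sign: "\<bar>x\<bar> \<le> a \<Longrightarrow> h x \<le> 0" "\<bar>x\<bar> \<ge> a \<Longrightarrow> h x \<ge> 0" for x
    using a by (simp_all add: h_def)
  have diff: "student_cdf p x - cdf std_normal_distribution x = (LBINT u:{..x}. h u)" for x
    unfolding student_cdf_def cdf_std_normal h_def
    using integrable_student_density[OF p]
    by (intro set_integral_diff(2)[symmetric])
       (auto simp: set_integrable_def intro!: integrable_mult_indicator simp del: real_scaleR_def)
  note * = int zero even less_imp_le[OF a(1)] sign
  have Ko: "d_Ko p = - (LBINT x:{-a..a}. h x) / 2"
    unfolding d_Ko_def diff by (rule Sup_abs_primitive_single_well[OF *])
  have TV: "d_TV p = - (LBINT x:{-a..a}. h x)"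
    unfolding d_TV_def using lbint_abs_single_well[OF *] by (simp add: h_def)
  show "1 / 2 * d_TV p = d_Ko p" using Ko TV by simp
  have neg: "(LBINT x:A. \<phi> x - student_density p x) = - (LBINT x:A. h x)" for A
    unfolding h_def set_lebesgue_integral_def
    by (subst Bochner_Integration.integral_minus[symmetric]) (simp add: algebra_simps)
  show "\<exists>a>0. a\<^sup>2 \<le> 3 \<and> 2 * d_Ko p = (LBINT x:{-a..a}. \<phi> x - student_density p x)"
    using a Ko neg by auto
  show "(LBINT x:{-b..b}. \<phi> x - student_density p x) \<le> 2 * d_Ko p" for b
    using integral_single_well_le[OF int sign, where A = "{-b..b}"] Ko neg[of "{-b..b}"] by simp
qed

section \<open>The first-order term and its maximum\<close>

text \<open>
  This is the coefficient of \<open>1 / p\<close> in the expansion of the difference between the normal and the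
  Student distribution function.
\<close>
definition edgeworth :: "real \<Rightarrow> real" where
  "edgeworth x = \<phi> x * x * (1 + x\<^sup>2) / 4"

lemma std_normal_density_deriv: "(\<phi> has_real_derivative (- x * \<phi> x)) (at x)"
proof -
  have "((\<lambda>x. c * exp (- x\<^sup>2 / 2)) has_real_derivative (- x * (c * exp (- x\<^sup>2 / 2)))) (at x)" for c
    by (auto intro!: derivative_eq_intros)
  thus ?thesis unfolding std_normal_density_def [abs_def] .
qed

lemma edgeworth_deriv:
  "(edgeworth has_real_derivative (- \<phi> x * ((x\<^sup>2)\<^sup>2 - 2 * x\<^sup>2 - 1) / 4)) (at x)"
proof -
  have "((\<lambda>x. \<phi> x * x * (1 + x\<^sup>2) / 4) has_real_derivative
     ((((- x * \<phi> x) * x + \<phi> x * 1) * (1 + x\<^sup>2) + \<phi> x * x * (2 * x)) / 4)) (at x)"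
    by (auto intro!: derivative_eq_intros std_normal_density_deriv)
  also have "(((- x * \<phi> x) * x + \<phi> x * 1) * (1 + x\<^sup>2) + \<phi> x * x * (2 * x)) / 4
      = - \<phi> x * ((x\<^sup>2)\<^sup>2 - 2 * x\<^sup>2 - 1) / 4"
    by (simp add: algebra_simps power2_eq_square)
  finally show ?thesis unfolding edgeworth_def [abs_def] .
qed

lemma edgeworth_at_max: "edgeworth (sqrt (1 + sqrt 2)) = const_C"
proof -
  define b where "b = sqrt (1 + sqrt 2)"
  have b2: "b\<^sup>2 = 1 + sqrt 2" by (simp add: b_def)
  have "sqrt ((7 + 5 * sqrt 2) / (pi * exp (1 + sqrt 2))) = 4 * edgeworth b"
  proof (rule real_sqrt_unique)
    have "(4 * edgeworth b)\<^sup>2 = (\<phi> b)\<^sup>2 * b\<^sup>2 * (1 + b\<^sup>2)\<^sup>2"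
      by (simp add: edgeworth_def power_mult_distrib power_divide)
    also have "\<dots> = (\<phi> b)\<^sup>2 * (b\<^sup>2 * (1 + b\<^sup>2)\<^sup>2)" by simp
    also have "(\<phi> b)\<^sup>2 = 1 / (2 * pi * exp (1 + sqrt 2))"
    proof -
      have "(exp (- (1 + sqrt 2) / 2))\<^sup>2 = exp (- (1 + sqrt 2))"
        unfolding power2_eq_square exp_add[symmetric] by simp
      hence "(\<phi> b)\<^sup>2 = 1 / (2 * pi) * exp (- (1 + sqrt 2))"
        unfolding std_normal_density_def b2 by (simp add: power_mult_distrib power_divide)
      moreover have "1 / (2 * pi) * exp (- s) = 1 / (2 * pi * exp s)" for s :: real
        by (simp add: exp_minus field_simps)
      ultimately show ?thesis by metis
    qed
    also have "b\<^sup>2 * (1 + b\<^sup>2)\<^sup>2 = 2 * (7 + 5 * sqrt 2)"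
      unfolding b2 by (simp add: power2_eq_square algebra_simps)
    also have "1 / (2 * pi * e) * (2 * c) = c / (pi * e)" for c e :: real by simp
    finally show "(4 * edgeworth b)\<^sup>2 = (7 + 5 * sqrt 2) / (pi * exp (1 + sqrt 2))" .
    show "4 * edgeworth b \<ge> 0" by (simp add: edgeworth_def b_def)
  qed
  thus ?thesis by (simp add: const_C_def b_def)
qed

text \<open>
  The derivative has the sign of \<open>2 - (x\<^sup>2 - 1)\<^sup>2\<close>.
\<close>
lemma edgeworth_le:
  assumes "x \<ge> 0"
  shows "edgeworth x \<le> const_C"
proof -
  define b where "b = sqrt (1 + sqrt 2)"
  have b: "b \<ge> 0" "b\<^sup>2 = 1 + sqrt 2" by (simp_all add: b_def)
  have q: "u\<^sup>2 - 2 * u - 1 = (u - 1)\<^sup>2 - 2" for u :: real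
    by (simp add: power2_eq_square algebra_simps)
  have "edgeworth x \<le> edgeworth b"
  proof (cases "x \<le> b")
    case True
    show ?thesis
    proof (rule DERIV_nonneg_imp_nondecreasing[OF True])
      fix y assume y: "x \<le> y" "y \<le> b"
      have "y\<^sup>2 \<le> 1 + sqrt 2" "y\<^sup>2 \<ge> 0" using y assms power_mono[of y b 2] b by auto
      moreover have "sqrt 2 \<ge> 1" by simp
      ultimately have "\<bar>y\<^sup>2 - 1\<bar> \<le> sqrt 2" unfolding abs_le_iff by linarith
      hence "(y\<^sup>2 - 1)\<^sup>2 \<le> 2" using sqrt_ge_absD[of "y\<^sup>2 - 1" 2] by simp
      hence "- \<phi> y * ((y\<^sup>2)\<^sup>2 - 2 * y\<^sup>2 - 1) / 4 \<ge> 0"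
        unfolding q by (simp add: mult_nonneg_nonpos)
      with edgeworth_deriv[of y]
      show "\<exists>d. (edgeworth has_real_derivative d) (at y) \<and> d \<ge> 0" by blast
    qed
  next
    case False
    hence "b \<le> x" by simp
    thus ?thesis
    proof (rule DERIV_nonpos_imp_nonincreasing)
      fix y assume y: "b \<le> y" "y \<le> x"
      have "y\<^sup>2 \<ge> 1 + sqrt 2" using y power_mono[of b y 2] b by auto
      hence "(sqrt 2)\<^sup>2 \<le> (y\<^sup>2 - 1)\<^sup>2" by (intro power_mono) auto
      hence "- \<phi> y * ((y\<^sup>2)\<^sup>2 - 2 * y\<^sup>2 - 1) / 4 \<le> 0"
        unfolding q by (simp add: mult_nonneg_nonneg)
      with edgeworth_deriv[of y]
      show "\<exists>d. (edgeworth has_real_derivative d) (at y) \<and> d \<le> 0" by blast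
    qed
  qed
  thus ?thesis using edgeworth_at_max by (simp add: b_def)
qed

section \<open>Bounds for the Kolmogorov distance\<close>

lemma d_Ko_less:
  assumes "p \<ge> 4"
  shows "d_Ko p < const_C / p"
proof -
  have p: "p > 0" using assms by simp
  obtain a where a: "a > 0" "a\<^sup>2 \<le> 3" "2 * d_Ko p = (LBINT x:{-a..a}. \<phi> x - student_density p x)"
    using d_Ko_well[OF assms] by blast
  define t where "t = 1 / p"
  have t: "0 < t" "t \<le> 1 / 4" using assms by (auto simp: t_def field_simps)
  define E where "E x = t * edgeworth x - t\<^sup>2 * (\<phi> x * x * correction t (x\<^sup>2))" for x
  define g where "g x = \<phi> x * (1 - minorant t (x\<^sup>2))" for x
  have deriv: "(E has_real_derivative g x) (at x)" for x
  proof -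
    have "((\<lambda>x. correction t (x\<^sup>2)) has_real_derivative (correction' t (x\<^sup>2) * (2 * x))) (at x)"
      by (rule DERIV_chain2[OF correction_deriv]) (auto intro!: derivative_eq_intros)
    note [derivative_intros] = this edgeworth_deriv std_normal_density_deriv
    have "(E has_real_derivative (t * (- \<phi> x * ((x\<^sup>2)\<^sup>2 - 2 * x\<^sup>2 - 1) / 4) -
      t\<^sup>2 * (((- x * \<phi> x) * x + \<phi> x * 1) * correction t (x\<^sup>2) + \<phi> x * x * (correction' t (x\<^sup>2) * (2 * x))))) (at x)"
      unfolding E_def [abs_def]
      by (rule derivative_eq_intros refl | simp add: algebra_simps)+
    also have "t * (- \<phi> x * ((x\<^sup>2)\<^sup>2 - 2 * x\<^sup>2 - 1) / 4) -
      t\<^sup>2 * (((- x * \<phi> x) * x + \<phi> x * 1) * correction t (x\<^sup>2) + \<phi> x * x * (correction' t (x\<^sup>2) * (2 * x))) = g x"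
      unfolding g_def minorant_def by (simp add: field_simps power2_eq_square)
    finally show ?thesis .
  qed
  have cont: "isCont g x" for x
    unfolding g_def minorant_poly std_normal_density_def by (intro continuous_intros) auto
  note FTC = set_integral_FTC_symmetric[OF less_imp_le[OF a(1)] deriv cont]
  have "(LBINT x:{-a..a}. \<phi> x - student_density p x) \<le> (LBINT x:{-a..a}. g x)"
  proof (rule set_integral_mono)
    show "set_integrable lborel {-a..a} (\<lambda>x. \<phi> x - student_density p x)"
      unfolding set_integrable_def
      by (rule integrable_mult_indicator[OF _ integrable_density_diff[OF p]]) simp
    fix x assume "x \<in> {-a..a}"
    hence "x\<^sup>2 \<le> a\<^sup>2" by (simp add: abs_le_square_iff[symmetric] abs_le_iff)
    hence "minorant t (x\<^sup>2) \<le> gamma_ratio p * kernel_ratio p (x\<^sup>2)"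
      unfolding t_def using assms a by (intro minorant_le_density_ratio) auto
    hence "\<phi> x * minorant t (x\<^sup>2) \<le> \<phi> x * (gamma_ratio p * kernel_ratio p (x\<^sup>2))"
      by (rule mult_left_mono) simp
    thus "\<phi> x - student_density p x \<le> g x"
      unfolding student_density_eq[OF p] g_def right_diff_distrib by simp
  qed (rule FTC(1))
  also have "\<dots> = E a - E (-a)" by (rule FTC(2))
  also have "E (-a) = - E a" by (simp add: E_def edgeworth_def std_normal_density_def)
  finally have "d_Ko p \<le> E a" using a by simp
  also have "E a < t * edgeworth a"
    using a t correction_pos[of t "a\<^sup>2"] by (simp add: E_def normal_density_pos)
  also have "\<dots> \<le> t * const_C"
    using edgeworth_le[of a] a t by (intro mult_left_mono) auto
  finally show ?thesis by (simp add: t_def)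
qed

text \<open>
  Here the integration runs over the interval determined by the maximum of \<open>edgeworth\<close> and not over the
  well, which only lowers the integral of \<open>\<phi> - f\<close>. The error term of the quotient of densities is
  integrated with the crude bounds \<open>\<phi> x \<le> 1\<close> and \<open>b \<le> 2\<close>.
\<close>
lemma d_Ko_ge_expansion:
  assumes "p \<ge> 4"
  shows "const_C / p - 10 / p\<^sup>2 \<le> d_Ko p"
proof -
  define b where "b = sqrt (1 + sqrt 2)"
  have "sqrt 2 \<le> 2" by (rule real_le_lsqrt) auto
  hence b: "0 \<le> b" "b\<^sup>2 \<le> 3" by (simp_all add: b_def)
  have "b \<le> 2" using b by (intro power2_le_imp_le[of b 2]) auto
  have p: "p > 0" using assms by simp
  define t where "t = 1 / p"
  have t: "t \<ge> 0" using p by (simp add: t_def)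
  define F where "F x = t * edgeworth x - 5 * t\<^sup>2 * x" for x
  define g where "g x = t * (- \<phi> x * ((x\<^sup>2)\<^sup>2 - 2 * x\<^sup>2 - 1) / 4) - 5 * t\<^sup>2" for x
  have deriv: "(F has_real_derivative g x) (at x)" for x
    unfolding F_def [abs_def] g_def
    by (rule derivative_eq_intros edgeworth_deriv refl | simp)+
  have cont: "isCont g x" for x
    unfolding g_def std_normal_density_def by (intro continuous_intros) auto
  note FTC = set_integral_FTC_symmetric[OF b(1) deriv cont]
  have "2 * (t * const_C - 5 * t\<^sup>2 * b) = F b - F (- b)"
    by (simp add: F_def flip: edgeworth_at_max) (simp add: edgeworth_def b_def std_normal_density_def)
  also have "\<dots> = (LBINT x:{-b..b}. g x)" by (rule FTC(2)[symmetric])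
  also have "\<dots> \<le> (LBINT x:{-b..b}. \<phi> x - student_density p x)"
  proof (rule set_integral_mono)
    show "set_integrable lborel {-b..b} (\<lambda>x. \<phi> x - student_density p x)"
      unfolding set_integrable_def
      by (rule integrable_mult_indicator[OF _ integrable_density_diff[OF p]]) simp
    fix x assume "x \<in> {-b..b}"
    hence "x\<^sup>2 \<le> b\<^sup>2" by (simp add: abs_le_square_iff[symmetric] abs_le_iff)
    hence "gamma_ratio p * kernel_ratio p (x\<^sup>2) \<le> 1 + ((x\<^sup>2)\<^sup>2 - 2 * x\<^sup>2 - 1) / (4 * p) + 5 / p\<^sup>2"
      using assms b by (intro density_ratio_le) auto
    hence "\<phi> x * (gamma_ratio p * kernel_ratio p (x\<^sup>2)) \<le> \<phi> x * (1 + t * ((x\<^sup>2)\<^sup>2 - 2 * x\<^sup>2 - 1) / 4 + 5 * t\<^sup>2)"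
      by (intro mult_left_mono) (auto simp: t_def power_divide)
    moreover have "\<phi> x * (5 * t\<^sup>2) \<le> 1 * (5 * t\<^sup>2)"
    proof (rule mult_right_mono)
      have "1 / sqrt (2 * pi) * exp (- x\<^sup>2 / 2) \<le> 1 * 1"
        using pi_ge_two by (intro mult_mono) (auto simp: divide_le_eq_1)
      thus "\<phi> x \<le> 1" by (simp add: std_normal_density_def)
    qed simp
    ultimately show "g x \<le> \<phi> x - student_density p x"
      unfolding student_density_eq[OF p] g_def by (simp add: field_simps)
  qed (rule FTC(1))
  also have "\<dots> \<le> 2 * d_Ko p" by (rule d_Ko_ge[OF assms])
  finally have "t * const_C - 5 * t\<^sup>2 * b \<le> d_Ko p" by simp
  moreover have "5 * t\<^sup>2 * b \<le> 10 * t\<^sup>2" using mult_left_mono[OF \<open>b \<le> 2\<close>, of "5 * t\<^sup>2"] by simp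
  ultimately have "t * const_C - 10 * t\<^sup>2 \<le> d_Ko p" by linarith
  thus ?thesis by (simp add: t_def power_divide)
qed

lemma d_Ko_asymptotics: "((\<lambda>p. p * d_Ko p) \<longlongrightarrow> const_C) at_top"
proof (rule tendsto_sandwich)
  show "\<forall>\<^sub>F p in at_top. const_C - 10 / p \<le> p * d_Ko p"
    using eventually_ge_at_top[of 4]
  proof eventually_elim
    case (elim p)
    have "p * (const_C / p - 10 / p\<^sup>2) \<le> p * d_Ko p"
      using d_Ko_ge_expansion[OF elim] elim by (intro mult_left_mono) auto
    also have "p * (const_C / p - 10 / p\<^sup>2) = const_C - 10 / p"
      using elim by (simp add: field_simps power2_eq_square)
    finally show ?case .
  qed
  show "\<forall>\<^sub>F p in at_top. p * d_Ko p \<le> const_C"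
    using eventually_ge_at_top[of 4]
  proof eventually_elim
    case (elim p)
    thus ?case using d_Ko_less[OF elim] by (simp add: field_simps)
  qed
  show "((\<lambda>p. const_C - 10 / p) \<longlongrightarrow> const_C) at_top" by real_asymp
qed auto

text \<open>
  The factor \<open>exp (1 + sqrt 2)\<close> is written as \<open>exp 1 * exp 1 * exp (sqrt 2 - 1)\<close>, so that the cubic
  Taylor polynomial, applied at \<open>sqrt 2 - 1\<close> and at \<open>1 - sqrt 2\<close>, is accurate enough.
\<close>
lemma const_C_bounds: "0.158 \<le> const_C" "const_C < 0.159"
proof -
  define y where "y = sqrt 2 - 1"
  have s2: "7071 / 5000 \<le> sqrt 2" "sqrt 2 \<le> 14143 / 10000"
    by (rule real_le_rsqrt, simp add: power2_eq_square) (rule real_le_lsqrt, auto simp: power2_eq_square)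
  have y2: "y\<^sup>2 = 3 - 2 * sqrt 2" by (simp add: y_def power2_eq_square algebra_simps)
  have y3: "y ^ 3 = 5 * sqrt 2 - 7"
    unfolding power3_eq_cube mult.assoc using y2
    by (simp add: y_def power2_eq_square algebra_simps)
  have lo: "7559 / 5000 \<le> exp y"
    using exp_ge_cubic[of y] s2 y2 y3 y_def by linarith
  have "3297 / 5000 \<le> exp (- y)"
  proof -
    have "1 - y + y\<^sup>2 / 2 - y ^ 3 / 6 \<le> exp (- y)"
      using exp_ge_cubic[of "- y"] by simp
    thus ?thesis using s2 y2 y3 y_def by linarith
  qed
  hence hi: "exp y \<le> 1.5170"
    by (simp add: exp_minus field_simps)
  have e: "2.7182 \<le> exp (1::real)" "exp (1::real) \<le> 2.7183"
    using e_approx_32 by (simp_all add: abs_if split: if_split_asm)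
  have split: "exp (1 + sqrt 2) = exp 1 * exp 1 * exp y"
    unfolding exp_add[symmetric] by (simp add: y_def)
  have E: "11.17 \<le> exp (1 + sqrt 2)" "exp (1 + sqrt 2) \<le> 11.21"
  proof -
    have "(2.7182 * 2.7182) * 1.5118 \<le> exp 1 * exp 1 * exp y"
      using e lo by (intro mult_mono) auto
    thus "11.17 \<le> exp (1 + sqrt 2)" unfolding split by simp
    have "exp 1 * exp 1 * exp y \<le> (2.7183 * 2.7183) * 1.5170"
      using e hi by (intro mult_mono) auto
    thus "exp (1 + sqrt 2) \<le> 11.21" unfolding split by simp
  qed
  define D where "D = pi * exp (1 + sqrt 2)"
  have D: "3.1415 * 11.17 \<le> D" "D \<le> 3.1416 * 11.21"
    unfolding D_def using pi_approx E by (intro mult_mono; simp)+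
  have "D > 0" unfolding D_def by simp
  \<comment> \<open>\<open>0.632\<close> and \<open>0.636\<close> are four times the claimed bounds.\<close>
  have "0.632\<^sup>2 * D \<le> 7 + 5 * sqrt 2" "7 + 5 * sqrt 2 < 0.636\<^sup>2 * D"
    using D s2 by (simp_all add: power2_eq_square)
  hence *: "0.632\<^sup>2 \<le> (7 + 5 * sqrt 2) / D" "(7 + 5 * sqrt 2) / D < 0.636\<^sup>2"
    using \<open>D > 0\<close> by (simp_all only: pos_le_divide_eq pos_divide_less_eq)
  have "0.632 \<le> sqrt ((7 + 5 * sqrt 2) / D)"
    using *(1) by (rule real_le_rsqrt)
  moreover have "sqrt ((7 + 5 * sqrt 2) / D) < 0.636"
    by (rule real_less_lsqrt[OF _ *(2)]) simp
  ultimately show "0.158 \<le> const_C" "const_C < 0.159"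
    unfolding const_C_def D_def by simp_all
qed

theorem theorem1p2:
  shows "(\<forall>p::real. p \<ge> 4 \<longrightarrow> 1 / 2 * d_TV p = d_Ko p \<and> d_Ko p < const_C / p)
       \<and> ((\<lambda>p::real. p * d_Ko p) \<longlongrightarrow> const_C) at_top
       \<and> (\<forall>C'::real. (\<forall>p::real. p \<ge> 4 \<longrightarrow> d_Ko p < C' / p) \<longrightarrow> const_C \<le> C')
       \<and> 0.158 \<le> const_C \<and> const_C < 0.159"
proof (intro conjI allI impI)
  fix C' :: real assume C': "\<forall>p\<ge>4. d_Ko p < C' / p"
  show "const_C \<le> C'"
  proof (rule tendsto_upperbound[OF d_Ko_asymptotics])
    show "\<forall>\<^sub>F p in at_top. p * d_Ko p \<le> C'"
      using eventually_ge_at_top[of 4]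
    proof eventually_elim
      case (elim p)
      thus ?case using C'[rule_format, OF elim] by (simp add: field_simps)
    qed
  qed simp
qed (use half_d_TV_eq_d_Ko d_Ko_less d_Ko_asymptotics const_C_bounds in auto)

end
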